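(* Let $R:\mathbb R^n\to\mathbb R$ be a twice continuously differentiable strongly convex function, let $\mathcal X\subseteq\mathbb R^n$ be a closed convex set, and let $\bar R(x)=R(x)+\mathcal I_{\mathcal X}(x)$. Let $x\in\mathcal X$ and $d\in\mathbb R^n$. Then $$\lim_{\alpha\downarrow0}\frac{\nabla\bar R^*(\nabla R(x)+\alpha d)-\nabla\bar R^*(\nabla R(x))}{\alpha}=\mathcal P^{x}_{\mathcal T_{\mathcal X}(x)}\big(\nabla^2R(x)^{-1}d\big).$$
   Context: $\mathcal I_{\mathcal X}$ is the indicator function of $\mathcal X$ ($0$ on $\mathcal X$, $+\infty$ elsewhere). $\bar R^*(z)=\sup_{y\in\mathbb R^n}\{\langle y,z\rangle-\bar R(y)\}$ is the convex conjugate; since $\bar R$ is strongly convex, $\bar R^*$ is continuously differentiable with $\nabla\bar R^*(z)=\operatorname{argmax}_{y\in\mathcal X}\{\langle y,z\rangle-R(y)\}$. The tangent cone is $\mathcal T_{\mathcal X}(x)=\{v: v=\lim_k(x_k-x)/t_k,\ x_k\in\mathcal X,\ t_k\downarrow0\}$. With $\|u\|_x^2=u^\top\nabla^2R(x)u$, the projection is $\mathcal P^x_{\mathcal T_{\mathcal X}(x)}(w)=\operatorname{argmin}_{\nu\in\mathcal T_{\mathcal X}(x)}\|\nu-w\|_x^2$. *)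

theory Defs
  imports "HOL-Analysis.Analysis"
begin

definition gradient :: "(real^'n \<Rightarrow> real) \<Rightarrow> real^'n \<Rightarrow> real^'n"
  where "gradient f x = (THE g. GDERIV f x :> g)"

definition hessian :: "(real^'n \<Rightarrow> real) \<Rightarrow> real^'n \<Rightarrow> real^'n^'n"
  where "hessian f x = jacobian (gradient f) (at x)"

definition twice_continuously_differentiable :: "(real^'n \<Rightarrow> real) \<Rightarrow> bool"
  where "twice_continuously_differentiable f \<longleftrightarrow>
    (\<forall>x. f differentiable (at x)) \<and>
    (\<forall>x. gradient f differentiable (at x)) \<and>
    continuous_on UNIV (hessian f)"

definition strongly_convex :: "(real^'n \<Rightarrow> real) \<Rightarrow> bool"
  where "strongly_convex f \<longleftrightarrow>
    (\<exists>\<mu>>0. \<forall>x y. \<forall>t\<in>{0..1}.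
       f ((1 - t) *\<^sub>R x + t *\<^sub>R y)
         \<le> (1 - t) * f x + t * f y - \<mu> / 2 * t * (1 - t) * (norm (x - y))\<^sup>2)"

definition convex_indicator :: "(real^'n) set \<Rightarrow> real^'n \<Rightarrow> ereal"
  where "convex_indicator X x = (if x \<in> X then 0 else \<infinity>)"

definition restrict_ext :: "(real^'n \<Rightarrow> real) \<Rightarrow> (real^'n) set \<Rightarrow> real^'n \<Rightarrow> ereal"
  where "restrict_ext R X x = ereal (R x) + convex_indicator X x"

definition convex_conjugate :: "(real^'n \<Rightarrow> ereal) \<Rightarrow> real^'n \<Rightarrow> ereal"
  where "convex_conjugate F z = (SUP y. ereal (y \<bullet> z) - F y)"

text \<open>An extended-real-valued function has a gradient only at points around which it is finite;
  this rules out spurious gradients arising from \<open>real_of_ereal\<close> sending infinite values to 0.\<close>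

definition ereal_has_gradient :: "(real^'n \<Rightarrow> ereal) \<Rightarrow> real^'n \<Rightarrow> real^'n \<Rightarrow> bool"
  where "ereal_has_gradient F z g \<longleftrightarrow>
    (\<forall>\<^sub>F y in nhds z. \<bar>F y\<bar> \<noteq> \<infinity>) \<and> GDERIV (\<lambda>y. real_of_ereal (F y)) z :> g"

definition ereal_gradient :: "(real^'n \<Rightarrow> ereal) \<Rightarrow> real^'n \<Rightarrow> real^'n"
  where "ereal_gradient F z = (THE g. ereal_has_gradient F z g)"

text \<open>As in \<open>\<alpha> \<down> 0\<close> for limits from the right, \<open>t\<^sub>k \<down> 0\<close> is read as
  convergence to 0 through positive values, without requiring monotonicity.\<close>

definition tangent_cone :: "(real^'n) set \<Rightarrow> real^'n \<Rightarrow> (real^'n) set"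
  where "tangent_cone X x =
    {v. \<exists>(xs :: nat \<Rightarrow> real^'n) (t :: nat \<Rightarrow> real).
          (\<forall>k. xs k \<in> X) \<and> (\<forall>k. t k > 0) \<and> t \<longlonglongrightarrow> 0 \<and>
          (\<lambda>k. (xs k - x) /\<^sub>R t k) \<longlonglongrightarrow> v}"

definition local_norm_sq :: "(real^'n \<Rightarrow> real) \<Rightarrow> real^'n \<Rightarrow> real^'n \<Rightarrow> real"
  where "local_norm_sq R x u = u \<bullet> (hessian R x *v u)"

definition local_projection ::
    "(real^'n \<Rightarrow> real) \<Rightarrow> real^'n \<Rightarrow> (real^'n) set \<Rightarrow> real^'n \<Rightarrow> real^'n"
  where "local_projection R x C w = (ARG_MIN (\<lambda>\<nu>. local_norm_sq R x (\<nu> - w)) \<nu>. \<nu> \<in> C)"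

end

theory Submission
  imports Defs
begin

text \<open>
  Let \<open>p z\<close> be the maximiser of \<open>y \<bullet> z - R y\<close> over \<open>X\<close>. Strong convexity with modulus \<open>\<mu>\<close>
  makes every such minimisation problem (for \<open>R y - y \<bullet> z\<close>) grow at least like
  \<open>\<mu> / 2 * \<parallel>y - p z\<parallel>\<^sup>2\<close> away from its solution
  (\<open>strongly_convex_minimiser\<close>). Hence \<open>p\<close> is Lipschitz with constant \<open>1 / \<mu>\<close>, and so the conjugate,
  a supremum of affine functions attained at \<open>p z\<close>, is differentiable with gradient \<open>p\<close>
  (\<open>ereal_gradient_conjugate\<close>). The gradient inequality gives \<open>p (\<nabla>R x) = x\<close>, so the claim is about
  the limit of \<open>v \<alpha> = (p (\<nabla>R x + \<alpha> d) - x) / \<alpha>\<close>.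

  The point \<open>v \<alpha>\<close> minimises, over the feasible set \<open>(X - x) / \<alpha>\<close>, the rescaled objective
  \<open>\<Phi>\<^sub>\<alpha> v = (R (x + \<alpha> v) - R x - \<alpha> v \<bullet> \<nabla>R x) / \<alpha>\<^sup>2 - v \<bullet> d\<close>.
  As \<open>\<alpha> \<down> 0\<close>, the objective converges uniformly on bounded sets to the quadratic
  \<open>\<Phi> v = v \<bullet> H v / 2 - v \<bullet> d\<close> with \<open>H = \<nabla>\<^sup>2R x\<close> (\<open>second_order_expansion\<close>), while the
  feasible sets increase to a cone whose closure is the tangent cone
  (\<open>tangent_cone_eq_closure\<close>). The Lipschitz bound keeps \<open>v \<alpha>\<close> bounded, and \<open>\<Phi>\<close> is strongly convex, so a
  nearly minimal value of \<open>\<Phi>\<close> forces closeness to its minimiser \<open>w\<close> over the tangent cone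
  (\<open>scaled_minimisers_converge\<close>).

  Finally, \<open>H\<close> is symmetric (\<open>derivative_of_gradient_symmetric\<close>) and \<open>v \<bullet> H v \<ge> \<mu> \<parallel>v\<parallel>\<^sup>2\<close>, so it is
  invertible, and completing the square shows that \<open>2 \<Phi>\<close> differs from the squared local distance to
  \<open>H\<^sup>-\<^sup>1 d\<close> only by a constant. So \<open>w\<close> is the local projection of \<open>H\<^sup>-\<^sup>1 d\<close>.
\<close>

section \<open>Strong convexity and minimisers\<close>

text \<open>
  The modulus is a parameter because the same \<open>\<mu>\<close> has to be carried from \<open>R\<close> to its quadratic model.
\<close>
definition strongly_convex_modulus :: "real \<Rightarrow> ('a::real_inner \<Rightarrow> real) \<Rightarrow> bool"
  where "strongly_convex_modulus \<mu> f \<longleftrightarrow>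
    (\<forall>x y. \<forall>t\<in>{0..1}.
       f ((1 - t) *\<^sub>R x + t *\<^sub>R y)
         \<le> (1 - t) * f x + t * f y - \<mu> / 2 * t * (1 - t) * (norm (x - y))\<^sup>2)"

lemma strongly_convex_modulus_minus_linear:
  assumes "strongly_convex_modulus \<mu> f"
  shows "strongly_convex_modulus \<mu> (\<lambda>y. f y - y \<bullet> z)"
  unfolding strongly_convex_modulus_def
proof (intro allI ballI)
  fix x y :: 'a and t :: real
  assume "t \<in> {0..1}"
  then have "f ((1 - t) *\<^sub>R x + t *\<^sub>R y)
      \<le> (1 - t) * f x + t * f y - \<mu> / 2 * t * (1 - t) * (norm (x - y))\<^sup>2"
    using assms unfolding strongly_convex_modulus_def by blast
  then show "f ((1 - t) *\<^sub>R x + t *\<^sub>R y) - ((1 - t) *\<^sub>R x + t *\<^sub>R y) \<bullet> z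
      \<le> (1 - t) * (f x - x \<bullet> z) + t * (f y - y \<bullet> z)
        - \<mu> / 2 * t * (1 - t) * (norm (x - y))\<^sup>2"
    by (simp add: inner_add_left inner_diff_left algebra_simps)
qed

lemma strongly_convex_chord_slope:
  assumes sc: "strongly_convex_modulus \<mu> f" and t: "0 < t" "t \<le> 1"
  shows "(f (x + t *\<^sub>R (y - x)) - f x) / t \<le> f y - f x - \<mu> / 2 * (1 - t) * (norm (y - x))\<^sup>2"
proof -
  have "x + t *\<^sub>R (y - x) = (1 - t) *\<^sub>R x + t *\<^sub>R y"
    by (simp add: algebra_simps)
  then have "f (x + t *\<^sub>R (y - x))
      \<le> (1 - t) * f x + t * f y - \<mu> / 2 * t * (1 - t) * (norm (y - x))\<^sup>2"
    using sc t unfolding strongly_convex_modulus_def by (auto simp: norm_minus_commute)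
  then have "f (x + t *\<^sub>R (y - x)) - f x
      \<le> t * (f y - f x - \<mu> / 2 * (1 - t) * (norm (y - x))\<^sup>2)"
    by (simp add: algebra_simps)
  then show ?thesis
    using t by (simp add: pos_divide_le_eq mult.commute)
qed

text \<open>
  A lower bound \<open>s t\<close> on the chord slopes near \<open>x\<close> turns into quadratic growth because the
  correction term of the chord inequality tends to \<open>\<mu> / 2 * \<parallel>y - x\<parallel>\<^sup>2\<close> as \<open>t \<down> 0\<close>. It is applied
  twice: with \<open>s\<close> the slope itself, converging to a directional derivative, and with \<open>s = 0\<close> at a
  minimiser, where the chord slopes are nonnegative.
\<close>
lemma quadratic_growth_from_slopes:
  assumes sc: "strongly_convex_modulus \<mu> f"
    and lim: "((\<lambda>t. s t) \<longlongrightarrow> l) (at_right (0::real))"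
    and slope: "\<And>t. 0 < t \<Longrightarrow> t \<le> 1 \<Longrightarrow> s t \<le> (f (x + t *\<^sub>R (y - x)) - f x) / t"
  shows "f x + l + \<mu> / 2 * (norm (y - x))\<^sup>2 \<le> f y"
proof -
  have "((\<lambda>t. f y - f x - \<mu> / 2 * (1 - t) * (norm (y - x))\<^sup>2)
      \<longlongrightarrow> f y - f x - \<mu> / 2 * (1 - 0) * (norm (y - x))\<^sup>2) (at_right 0)"
    by (intro tendsto_intros)
  moreover have "\<forall>\<^sub>F t in at_right 0. s t \<le> f y - f x - \<mu> / 2 * (1 - t) * (norm (y - x))\<^sup>2"
    unfolding eventually_at_right_field
  proof (intro exI[of _ 1] conjI allI impI)
    fix t :: real assume "0 < t" "t < 1"
    then show "s t \<le> f y - f x - \<mu> / 2 * (1 - t) * (norm (y - x))\<^sup>2"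
      using order_trans[OF slope strongly_convex_chord_slope[OF sc]] by simp
  qed simp
  ultimately have "l \<le> f y - f x - \<mu> / 2 * (1 - 0) * (norm (y - x))\<^sup>2"
    using lim by (intro tendsto_le[of "at_right 0"]) auto
  then show ?thesis by simp
qed

lemma GDERIV_ray:
  assumes "GDERIV f (x + s *\<^sub>R h) :> D"
  shows "((\<lambda>t. f (x + t *\<^sub>R h)) has_real_derivative h \<bullet> D) (at s within S)"
proof -
  have "((\<lambda>t. x + t *\<^sub>R h) has_derivative (\<lambda>t. t *\<^sub>R h)) (at s within S)"
    by (auto intro!: derivative_eq_intros)
  moreover have "(f has_derivative (\<lambda>k. k \<bullet> D)) (at (x + s *\<^sub>R h))"
    using assms by (simp add: gderiv_def)
  ultimately have "((\<lambda>t. f (x + t *\<^sub>R h)) has_derivative (\<lambda>t. (t *\<^sub>R h) \<bullet> D)) (at s within S)"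
    by (rule has_derivative_compose)
  then show ?thesis
    by (simp add: has_field_derivative_def mult.commute[of _ "h \<bullet> D"] mult_commute_abs)
qed

lemma strongly_convex_gradient_inequality:
  assumes sc: "strongly_convex_modulus \<mu> f" and g: "GDERIV f x :> g"
  shows "f x + (y - x) \<bullet> g + \<mu> / 2 * (norm (y - x))\<^sup>2 \<le> f y"
proof (rule quadratic_growth_from_slopes[OF sc])
  have "((\<lambda>t. f (x + t *\<^sub>R (y - x))) has_real_derivative (y - x) \<bullet> g) (at 0 within {0<..})"
    by (rule GDERIV_ray) (simp add: g)
  then show "((\<lambda>t. (f (x + t *\<^sub>R (y - x)) - f x) / t) \<longlongrightarrow> (y - x) \<bullet> g) (at_right 0)"
    by (simp add: has_field_derivative_iff)
qed auto

text \<open>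
  The gradient inequality at \<open>c\<close> makes \<open>f\<close> exceed \<open>f c\<close> outside a ball, so minimising over the
  compact part of \<open>C\<close> in that ball suffices.
\<close>
lemma strongly_convex_minimiser:
  fixes f :: "'a::euclidean_space \<Rightarrow> real"
  assumes mu: "\<mu> > 0" and sc: "strongly_convex_modulus \<mu> f"
    and C: "closed C" "convex C" "c \<in> C"
    and cont: "continuous_on C f" and g: "GDERIV f c :> g"
  obtains p where "p \<in> C" "\<And>y. y \<in> C \<Longrightarrow> f p + \<mu> / 2 * (norm (y - p))\<^sup>2 \<le> f y"
proof -
  \<comment> \<open>Beyond this radius the quadratic term outweighs the linear term \<open>(y - c) \<bullet> g\<close>.\<close>
  define r where "r = 2 * norm g / \<mu>"
  have far: "f c < f y" if "norm (y - c) > r" for y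
  proof -
    have pos: "norm (y - c) > 0"
      using that mu by (smt (verit) r_def divide_nonneg_pos norm_ge_zero)
    have "norm g < \<mu> / 2 * norm (y - c)"
      using that mu by (simp add: r_def field_simps)
    then have "norm (y - c) * norm g < \<mu> / 2 * (norm (y - c))\<^sup>2"
      using mult_strict_left_mono[OF \<open>norm g < _\<close> pos] by (simp add: power2_eq_square mult.left_commute)
    moreover have "- (norm (y - c) * norm g) \<le> (y - c) \<bullet> g"
      using Cauchy_Schwarz_ineq2[of "y - c" g] by linarith
    ultimately show ?thesis
      using strongly_convex_gradient_inequality[OF sc g, of y] by linarith
  qed
  have "compact (C \<inter> cball c r)"
    using C by (intro closed_Int_compact) auto
  moreover have "c \<in> C \<inter> cball c r"
    using C mu by (simp add: r_def)
  moreover have "continuous_on (C \<inter> cball c r) f"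
    using cont by (rule continuous_on_subset) auto
  ultimately obtain p where p: "p \<in> C \<inter> cball c r" and min: "\<And>y. y \<in> C \<inter> cball c r \<Longrightarrow> f p \<le> f y"
    using continuous_attains_inf[of "C \<inter> cball c r" f] by blast
  have pmin: "f p \<le> f y" if "y \<in> C" for y
  proof (cases "y \<in> cball c r")
    case False
    then have "f c < f y"
      by (intro far) (simp add: dist_norm norm_minus_commute)
    with min[OF \<open>c \<in> C \<inter> cball c r\<close>] show ?thesis by linarith
  qed (use min that in blast)
  show thesis
  proof (rule that[of p])
    show "p \<in> C" using p by blast
    fix y assume y: "y \<in> C"
    have "f p + 0 + \<mu> / 2 * (norm (y - p))\<^sup>2 \<le> f y"
    proof (rule quadratic_growth_from_slopes[OF sc])
      show "((\<lambda>t. 0::real) \<longlongrightarrow> 0) (at_right (0::real))" by simp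
      fix t :: real assume t: "0 < t" "t \<le> 1"
      have "p + t *\<^sub>R (y - p) = (1 - t) *\<^sub>R p + t *\<^sub>R y"
        by (simp add: algebra_simps)
      also have "\<dots> \<in> C"
        using C p y t by (intro convexD) auto
      finally show "0 \<le> (f (p + t *\<^sub>R (y - p)) - f p) / t"
        using pmin t by simp
    qed
    then show "f p + \<mu> / 2 * (norm (y - p))\<^sup>2 \<le> f y" by simp
  qed
qed

section \<open>The gradient of the conjugate\<close>

lemma GDERIV_uniqueness: "GDERIV f x :> a \<Longrightarrow> GDERIV f x :> b \<Longrightarrow> a = b"
proof -
  assume "GDERIV f x :> a" "GDERIV f x :> b"
  then have "(\<lambda>h. h \<bullet> a) = (\<lambda>h. h \<bullet> b)"
    unfolding gderiv_def by (rule has_derivative_unique)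
  then show "a = b"
    by (metis vector_eq_ldot)
qed

lemma ereal_gradient_eqI:
  assumes "ereal_has_gradient F z g"
  shows "ereal_gradient F z = g"
  unfolding ereal_gradient_def
  using assms GDERIV_uniqueness unfolding ereal_has_gradient_def by (intro the_equality) blast+

text \<open>
  Adding the growth inequalities of the two problems at each other's solutions cancels all values of
  \<open>R\<close> and leaves \<open>\<mu> \<parallel>p w - p z\<parallel>\<^sup>2 \<le> (p w - p z) \<bullet> (w - z)\<close>.
\<close>
lemma argmin_selection_Lipschitz:
  fixes p :: "'a::real_inner \<Rightarrow> 'a"
  assumes mu: "\<mu> > 0" and pX: "\<And>z. p z \<in> X"
    and growth: "\<And>z y. y \<in> X \<Longrightarrow> R (p z) - p z \<bullet> z + \<mu> / 2 * (norm (y - p z))\<^sup>2 \<le> R y - y \<bullet> z"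
  shows "norm (p w - p z) \<le> norm (w - z) / \<mu>"
proof -
  have "\<mu> * (norm (p w - p z))\<^sup>2 \<le> (p w - p z) \<bullet> (w - z)"
    using growth[OF pX[of w], of z] growth[OF pX[of z], of w]
    by (simp add: inner_diff_left inner_diff_right norm_minus_commute)
  also have "\<dots> \<le> norm (p w - p z) * norm (w - z)"
    by (rule norm_cauchy_schwarz)
  finally have "norm (p w - p z) * (\<mu> * norm (p w - p z)) \<le> norm (p w - p z) * norm (w - z)"
    by (simp add: power2_eq_square mult.left_commute)
  then have "\<mu> * norm (p w - p z) \<le> norm (w - z)"
    by (cases "p w = p z") (auto simp: mult_le_cancel_left)
  with mu show ?thesis
    by (simp add: pos_le_divide_eq mult.commute)
qed

lemma convex_conjugate_restrict_ext:
  assumes "p \<in> X" and "\<And>y. y \<in> X \<Longrightarrow> R p - p \<bullet> z \<le> R y - y \<bullet> z"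
  shows "convex_conjugate (restrict_ext R X) z = ereal (p \<bullet> z - R p)"
  unfolding convex_conjugate_def
proof (rule SUP_eqI)
  fix y
  show "ereal (y \<bullet> z) - restrict_ext R X y \<le> ereal (p \<bullet> z - R p)"
    using assms(2)[of y] by (cases "y \<in> X") (auto simp: restrict_ext_def convex_indicator_def)
next
  fix u assume "\<And>y. y \<in> UNIV \<Longrightarrow> ereal (y \<bullet> z) - restrict_ext R X y \<le> u"
  from this[of p] show "ereal (p \<bullet> z - R p) \<le> u"
    using assms(1) by (simp add: restrict_ext_def convex_indicator_def)
qed

text \<open>
  Since \<open>p z\<close> competes in the supremum at \<open>w\<close> and vice versa, the first-order error
  \<open>F w - F z - (w - z) \<bullet> p z\<close> lies between \<open>0\<close> and \<open>(w - z) \<bullet> (p w - p z)\<close>, which is of second order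
  by the Lipschitz bound.
\<close>
lemma ereal_gradient_conjugate:
  assumes mu: "\<mu> > 0" and pX: "\<And>z. p z \<in> X"
    and growth: "\<And>z y. y \<in> X \<Longrightarrow> R (p z) - p z \<bullet> z + \<mu> / 2 * (norm (y - p z))\<^sup>2 \<le> R y - y \<bullet> z"
  shows "ereal_gradient (convex_conjugate (restrict_ext R X)) z = p z"
proof (rule ereal_gradient_eqI)
  have le: "R (p z) - p z \<bullet> z \<le> R y - y \<bullet> z" if "y \<in> X" for y z
    using growth[OF that, of z] mu by (smt (verit) mult_nonneg_nonneg half_gt_zero zero_le_power2)
  define F where "F z = p z \<bullet> z - R (p z)" for z
  have conj: "convex_conjugate (restrict_ext R X) = (\<lambda>z. ereal (F z))"
    unfolding F_def by (intro ext convex_conjugate_restrict_ext pX le)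
  have bound: "\<bar>F w - F z - (w - z) \<bullet> p z\<bar> \<le> norm (w - z) * (norm (w - z) / \<mu>)" for w
  proof -
    have "0 \<le> F w - F z - (w - z) \<bullet> p z"
      using le[OF pX[of z], of w] by (simp add: F_def inner_diff_left inner_diff_right inner_commute[of _ "p z"])
    moreover have "F w - F z - (w - z) \<bullet> p z \<le> (w - z) \<bullet> (p w - p z)"
      using le[OF pX[of w], of z] by (simp add: F_def inner_diff_left inner_diff_right inner_commute[of _ "p z"] inner_commute[of _ "p w"])
    moreover have "(w - z) \<bullet> (p w - p z) \<le> norm (w - z) * norm (p w - p z)"
      by (rule norm_cauchy_schwarz)
    moreover have "\<dots> \<le> norm (w - z) * (norm (w - z) / \<mu>)"
      using argmin_selection_Lipschitz[OF mu pX growth] by (intro mult_left_mono) auto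
    ultimately show ?thesis by linarith
  qed
  have "GDERIV F z :> p z"
    unfolding gderiv_def
  proof (rule has_derivativeI_sandwich[of 1])
    show "bounded_linear (\<lambda>h. h \<bullet> p z)" by (rule bounded_linear_inner_left)
    show "((\<lambda>w. norm (w - z) / \<mu>) \<longlongrightarrow> 0) (at z)"
      using mu by (auto intro!: tendsto_eq_intros)
    fix w assume "w \<noteq> z"
    then have "norm (F w - F z - (w - z) \<bullet> p z) \<le> norm (w - z) / \<mu> * norm (w - z)"
      using bound[of w] by (simp add: mult.commute)
    then show "norm (F w - F z - (w - z) \<bullet> p z) / norm (w - z) \<le> norm (w - z) / \<mu>"
      using \<open>w \<noteq> z\<close> by (simp add: pos_divide_le_eq)
  qed simp
  then show "ereal_has_gradient (convex_conjugate (restrict_ext R X)) z (p z)"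
    by (simp add: ereal_has_gradient_def conj)
qed

section \<open>The tangent cone of a convex set\<close>

text \<open>
  The union of the sets \<open>(X - x) / t\<close> over \<open>t > 0\<close>: the cone generated by \<open>X - x\<close> if \<open>x \<in> X\<close>.
\<close>
definition feasible_directions :: "'a::real_vector set \<Rightarrow> 'a \<Rightarrow> 'a set"
  where "feasible_directions X x = {v. \<exists>t>0. x + t *\<^sub>R v \<in> X}"

lemma convex_shorter_step:
  assumes "convex X" "x \<in> X" "x + t *\<^sub>R v \<in> X" "0 < s" "s \<le> t"
  shows "x + s *\<^sub>R v \<in> X"
proof -
  have "(1 - s / t) *\<^sub>R x + (s / t) *\<^sub>R (x + t *\<^sub>R v) \<in> X"
    using assms by (intro convexD) auto
  moreover have "(1 - s / t) *\<^sub>R x + (s / t) *\<^sub>R (x + t *\<^sub>R v) = x + s *\<^sub>R v"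
    using assms by (simp add: algebra_simps)
  ultimately show ?thesis by simp
qed

lemma convex_feasible_directions:
  assumes "convex X" "x \<in> X"
  shows "convex (feasible_directions X x)"
proof (rule convexI)
  fix a b and u v :: real
  assume ab: "a \<in> feasible_directions X x" "b \<in> feasible_directions X x"
    and uv: "0 \<le> u" "0 \<le> v" "u + v = 1"
  from ab obtain s t where st: "s > 0" "x + s *\<^sub>R a \<in> X" "t > 0" "x + t *\<^sub>R b \<in> X"
    by (auto simp: feasible_directions_def)
  define r where "r = min s t"
  have r: "r > 0" "x + r *\<^sub>R a \<in> X" "x + r *\<^sub>R b \<in> X"
    using st convex_shorter_step[OF assms, of _ _ r] by (auto simp: r_def)
  have "u *\<^sub>R (x + r *\<^sub>R a) + v *\<^sub>R (x + r *\<^sub>R b) \<in> X"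
    using r uv assms by (intro convexD) auto
  also have "u *\<^sub>R (x + r *\<^sub>R a) + v *\<^sub>R (x + r *\<^sub>R b)
      = (u + v) *\<^sub>R x + r *\<^sub>R (u *\<^sub>R a + v *\<^sub>R b)"
    by (simp only: scaleR_add_left scaleR_add_right scaleR_scaleR) (simp add: mult.commute)
  finally show "u *\<^sub>R a + v *\<^sub>R b \<in> feasible_directions X x"
    using r uv by (auto simp: feasible_directions_def)
qed

text \<open>
  A limit of feasible directions \<open>u k\<close> is tangent because convexity allows the steps along \<open>u k\<close>
  to be shortened, so that they tend to \<open>0\<close> while the directions stay the same.
\<close>
lemma tangent_cone_eq_closure:
  assumes X: "convex X" "x \<in> X"
  shows "tangent_cone X x = closure (feasible_directions X x)"
proof (intro equalityI subsetI)
  fix v assume "v \<in> tangent_cone X x"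
  then obtain xs t where xs: "\<And>k. xs k \<in> X" "\<And>k. t k > (0::real)"
    and lim: "(\<lambda>k. (xs k - x) /\<^sub>R t k) \<longlonglongrightarrow> v"
    by (auto simp: tangent_cone_def)
  have "(xs k - x) /\<^sub>R t k \<in> feasible_directions X x" for k
    unfolding feasible_directions_def
    using xs[of k] by (auto intro!: exI[of _ "t k"])
  with lim show "v \<in> closure (feasible_directions X x)"
    unfolding closure_sequential by (intro exI[of _ "\<lambda>k. (xs k - x) /\<^sub>R t k"]) simp
next
  fix v assume "v \<in> closure (feasible_directions X x)"
  then obtain u where u: "\<And>k. u k \<in> feasible_directions X x" and lim: "u \<longlonglongrightarrow> v"
    by (auto simp: closure_sequential)
  have "\<forall>k. \<exists>t>0. x + t *\<^sub>R u k \<in> X"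
    using u by (auto simp: feasible_directions_def)
  then obtain t where t: "\<And>k. t k > 0" "\<And>k. x + t k *\<^sub>R u k \<in> X"
    by metis
  define s where "s k = min (t k) (1 / real (Suc k))" for k
  have s: "s k > 0" "s k \<le> t k" "s k \<le> 1 / real (Suc k)" for k
    using t(1)[of k] by (auto simp: s_def)
  have "s \<longlonglongrightarrow> 0"
  proof (rule tendsto_sandwich[of "\<lambda>_. 0"])
    show "(\<lambda>k. 1 / real (Suc k)) \<longlonglongrightarrow> 0"
      using LIMSEQ_inverse_real_of_nat by (simp add: inverse_eq_divide)
  qed (use s in \<open>auto intro!: always_eventually less_imp_le\<close>)
  moreover have "x + s k *\<^sub>R u k \<in> X" for k
    using convex_shorter_step[OF X t(2) s(1,2)] .
  moreover have "(\<lambda>k. (x + s k *\<^sub>R u k - x) /\<^sub>R s k) = u"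
    using s(1) by (auto simp: fun_eq_iff less_imp_neq[symmetric])
  ultimately show "v \<in> tangent_cone X x"
    unfolding tangent_cone_def mem_Collect_eq
    using s(1) lim by (intro exI[of _ "\<lambda>k. x + s k *\<^sub>R u k"] exI[of _ s]) simp
qed

section \<open>Second-order expansion and the Hessian\<close>

lemma GDERIV_gradient:
  assumes "f differentiable (at x)"
  shows "GDERIV f x :> gradient f x"
proof -
  obtain f' where f': "(f has_derivative f') (at x)"
    using assms by (auto simp: differentiable_def)
  then have "linear f'"
    by (rule has_derivative_linear)
  then have "f' = (\<lambda>h. h \<bullet> adjoint f' 1)"
    by (simp add: fun_eq_iff adjoint_works)
  with f' have D: "GDERIV f x :> adjoint f' 1"
    by (simp add: gderiv_def)
  then show ?thesis
    unfolding gradient_def by (rule theI) (rule GDERIV_uniqueness[OF _ D])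
qed

text \<open>
  The mean value theorem, applied along the segment to the remainder \<open>\<phi>\<close>, reduces the claim to the
  first-order expansion of \<open>g\<close> at \<open>x\<close>.
\<close>
lemma second_order_expansion:
  fixes f :: "'a::real_inner \<Rightarrow> real"
  assumes g: "\<And>y. GDERIV f y :> g y" and H: "(g has_derivative H) (at x)" and e: "e > 0"
  obtains r where "r > 0"
    "\<And>h. norm h < r \<Longrightarrow> \<bar>f (x + h) - f x - h \<bullet> g x - h \<bullet> H h / 2\<bar> \<le> e * (norm h)\<^sup>2"
proof -
  have lin: "linear H"
    using H by (rule has_derivative_linear)
  obtain r where r: "r > 0"
    and g_exp: "\<And>y. norm (y - x) < r \<Longrightarrow> norm (g y - g x - H (y - x)) \<le> e * norm (y - x)"
    using H e unfolding has_derivative_at_alt by blast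
  show thesis
  proof (rule that[OF r])
    fix h :: 'a assume h: "norm h < r"
    define \<phi> where "\<phi> s = f (x + s *\<^sub>R h) - s * (h \<bullet> g x) - s\<^sup>2 * (h \<bullet> H h / 2)" for s
    have d\<phi>: "(\<phi> has_real_derivative h \<bullet> g (x + s *\<^sub>R h) - h \<bullet> g x - s * (h \<bullet> H h)) (at s)" for s
      unfolding \<phi>_def
      by (auto intro!: derivative_eq_intros GDERIV_ray[OF g])
    obtain s where s: "0 < s" "s < 1"
      and mvt: "\<phi> 1 - \<phi> 0 = (1 - 0) * (h \<bullet> g (x + s *\<^sub>R h) - h \<bullet> g x - s * (h \<bullet> H h))"
      using MVT2[of 0 1 \<phi>, OF zero_less_one d\<phi>] by blast
    have "norm (s *\<^sub>R h) \<le> norm h"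
      using s by (simp add: mult_left_le_one_le)
    with g_exp[of "x + s *\<^sub>R h"] h
    have "norm (g (x + s *\<^sub>R h) - g x - H (s *\<^sub>R h)) \<le> e * norm h"
      using e by (smt (verit) add_diff_cancel_left' mult_left_mono)
    then have "norm h * norm (g (x + s *\<^sub>R h) - g x - H (s *\<^sub>R h)) \<le> e * (norm h)\<^sup>2"
      using mult_left_mono[of _ _ "norm h"] by (fastforce simp: power2_eq_square mult.left_commute)
    moreover have "\<phi> 1 - \<phi> 0 = h \<bullet> (g (x + s *\<^sub>R h) - g x - H (s *\<^sub>R h))"
      unfolding mvt by (simp add: inner_diff_right linear_cmul[OF lin])
    ultimately have "\<bar>\<phi> 1 - \<phi> 0\<bar> \<le> e * (norm h)\<^sup>2"
      using Cauchy_Schwarz_ineq2 order_trans by metis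
    then show "\<bar>f (x + h) - f x - h \<bullet> g x - h \<bullet> H h / 2\<bar> \<le> e * (norm h)\<^sup>2"
      by (simp add: \<phi>_def algebra_simps)
  qed
qed

text \<open>
  The expression under the limit is symmetric in \<open>u\<close> and \<open>v\<close>, while the mean value theorem in the direction
  \<open>v\<close> evaluates it as \<open>v \<bullet> H u\<close>. This is what makes the derivative of a gradient symmetric.
\<close>
lemma second_difference_limit:
  fixes f :: "'a::real_inner \<Rightarrow> real"
  assumes g: "\<And>y. GDERIV f y :> g y" and H: "(g has_derivative H) (at x)"
  shows "((\<lambda>s. (f (x + s *\<^sub>R (u + v)) - f (x + s *\<^sub>R u) - f (x + s *\<^sub>R v) + f x) / s\<^sup>2)
    \<longlongrightarrow> v \<bullet> H u) (at_right 0)"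
proof (rule tendstoI)
  fix e :: real assume e: "e > 0"
  have lin: "linear H"
    using H by (rule has_derivative_linear)
  \<comment> \<open>\<open>c * s * K\<close> will bound the error \<open>\<bar>v \<bullet> \<rho>\<bar>\<close> below; the summands \<open>1\<close> only keep \<open>K\<close> positive.\<close>
  define K where "K = (norm u + 2 * norm v + 1) * (norm v + 1)"
  have K: "K > 0"
    by (simp add: K_def add_pos_nonneg add_nonneg_pos)
  define c where "c = e / (2 * K)"
  have c: "c > 0" using e K by (simp add: c_def)
  obtain r where r: "r > 0"
    and g_exp: "\<And>y. norm (y - x) < r \<Longrightarrow> norm (g y - g x - H (y - x)) \<le> c * norm (y - x)"
    using H c unfolding has_derivative_at_alt by blast
  define s0 where "s0 = r / (norm u + norm v + 1)"
  have s0: "s0 > 0" using r by (simp add: s0_def add_nonneg_pos)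
  have "dist ((f (x + s *\<^sub>R (u + v)) - f (x + s *\<^sub>R u) - f (x + s *\<^sub>R v) + f x) / s\<^sup>2) (v \<bullet> H u) < e"
    if s: "0 < s" "s < s0" for s
  proof -
    have sr: "s * (norm u + norm v + 1) < r"
      using s by (simp add: s0_def pos_less_divide_eq add_nonneg_pos)
    define \<psi> where "\<psi> t = f (x + s *\<^sub>R u + t *\<^sub>R (s *\<^sub>R v)) - f (x + t *\<^sub>R (s *\<^sub>R v))" for t
    have d\<psi>: "(\<psi> has_real_derivative
        (s *\<^sub>R v) \<bullet> g (x + s *\<^sub>R u + t *\<^sub>R (s *\<^sub>R v)) - (s *\<^sub>R v) \<bullet> g (x + t *\<^sub>R (s *\<^sub>R v))) (at t)" for t
      unfolding \<psi>_def by (intro DERIV_diff GDERIV_ray g)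
    obtain t where t: "0 < t" "t < 1"
      and mvt: "\<psi> 1 - \<psi> 0 = (1 - 0) *
        ((s *\<^sub>R v) \<bullet> g (x + s *\<^sub>R u + t *\<^sub>R (s *\<^sub>R v)) - (s *\<^sub>R v) \<bullet> g (x + t *\<^sub>R (s *\<^sub>R v)))"
      using MVT2[of 0 1 \<psi>, OF zero_less_one d\<psi>] by blast
    \<comment> \<open>The two points at which the mean value theorem evaluates \<open>g\<close> are \<open>x + a\<close> and \<open>x + b\<close>.\<close>
    define a where "a = s *\<^sub>R u + t *\<^sub>R (s *\<^sub>R v)"
    define b where "b = t *\<^sub>R (s *\<^sub>R v)"
    have nb: "norm b \<le> s * norm v"
      using s t by (simp add: b_def mult_left_le_one_le)
    have na: "norm a \<le> s * (norm u + norm v)"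
    proof -
      have "norm a \<le> norm (s *\<^sub>R u) + norm b"
        unfolding a_def b_def by (rule norm_triangle_ineq)
      also have "\<dots> \<le> s * norm u + s * norm v"
        using nb s by simp
      finally show ?thesis by (simp add: distrib_left)
    qed
    have "norm b < r" "norm a < r"
      using na nb sr s by (auto simp: distrib_left intro: le_less_trans)
         (smt (verit, best) mult_nonneg_nonneg norm_ge_zero)+
    then have ga: "norm (g (x + a) - g x - H a) \<le> c * norm a"
      and gb: "norm (g (x + b) - g x - H b) \<le> c * norm b"
      using g_exp[of "x + a"] g_exp[of "x + b"] by auto
    have Hab: "H a - H b = s *\<^sub>R H u"
      using linear_diff[OF lin, of a b] linear_cmul[OF lin] by (simp add: a_def b_def)
    define \<rho> where "\<rho> = (g (x + a) - g x - H a) - (g (x + b) - g x - H b)"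
    have "norm \<rho> \<le> c * norm a + c * norm b"
      unfolding \<rho>_def using ga gb norm_triangle_ineq4 by (smt (verit))
    also have "\<dots> \<le> c * (s * (norm u + norm v)) + c * (s * norm v)"
      using na nb c by (intro add_mono mult_left_mono) auto
    finally have \<rho>: "norm \<rho> \<le> c * s * (norm u + 2 * norm v)"
      by (simp add: algebra_simps)
    have "f (x + s *\<^sub>R (u + v)) - f (x + s *\<^sub>R u) - f (x + s *\<^sub>R v) + f x = \<psi> 1 - \<psi> 0"
      by (simp add: \<psi>_def algebra_simps)
    also have "\<dots> = s * (v \<bullet> (g (x + a) - g (x + b)))"
      unfolding mvt a_def b_def by (simp add: inner_diff_right algebra_simps)
    also have "g (x + a) - g (x + b) = \<rho> + s *\<^sub>R H u"
      unfolding \<rho>_def Hab[symmetric] by simp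
    also have "s * (v \<bullet> (\<rho> + s *\<^sub>R H u)) = s * (v \<bullet> \<rho>) + s\<^sup>2 * (v \<bullet> H u)"
      by (simp add: inner_add_right power2_eq_square algebra_simps)
    finally have "(f (x + s *\<^sub>R (u + v)) - f (x + s *\<^sub>R u) - f (x + s *\<^sub>R v) + f x) / s\<^sup>2 - v \<bullet> H u
        = (v \<bullet> \<rho>) / s"
      using s by (simp add: power2_eq_square add_divide_distrib)
    moreover have "\<bar>v \<bullet> \<rho>\<bar> / s < e"
    proof -
      have "\<bar>v \<bullet> \<rho>\<bar> \<le> norm v * (c * s * (norm u + 2 * norm v))"
        using Cauchy_Schwarz_ineq2[of v \<rho>] \<rho> by (meson mult_left_mono norm_ge_zero order_trans)
      also have "\<dots> = c * s * ((norm u + 2 * norm v) * norm v)"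
        by simp
      also have "\<dots> \<le> c * s * K"
        using c s by (intro mult_left_mono) (auto simp: K_def intro!: mult_mono)
      also have "\<dots> = e / 2 * s"
        using K by (simp add: c_def)
      also have "\<dots> < e * s"
        using e s by simp
      finally show ?thesis using s by (simp add: pos_divide_less_eq)
    qed
    ultimately show ?thesis
      using s by (simp add: dist_real_def)
  qed
  then show "\<forall>\<^sub>F s in at_right 0.
      dist ((f (x + s *\<^sub>R (u + v)) - f (x + s *\<^sub>R u) - f (x + s *\<^sub>R v) + f x) / s\<^sup>2) (v \<bullet> H u) < e"
    using s0 unfolding eventually_at_right_field by blast
qed

lemma derivative_of_gradient_symmetric:
  fixes f :: "'a::real_inner \<Rightarrow> real"
  assumes g: "\<And>y. GDERIV f y :> g y" and H: "(g has_derivative H) (at x)"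
  shows "v \<bullet> H u = u \<bullet> H v"
proof -
  have "((\<lambda>s. (f (x + s *\<^sub>R (u + v)) - f (x + s *\<^sub>R u) - f (x + s *\<^sub>R v) + f x) / s\<^sup>2)
      \<longlongrightarrow> u \<bullet> H v) (at_right 0)"
    using second_difference_limit[OF g H, of v u] by (simp add: add.commute algebra_simps)
  with second_difference_limit[OF g H, of u v] show ?thesis
    by (intro tendsto_unique[of "at_right (0::real)"]) auto
qed

text \<open>
  Comparing the gradient inequality with the second-order expansion at \<open>x + s v\<close> and dividing by
  \<open>s\<^sup>2\<close> leaves the bound up to an arbitrarily small error.
\<close>
lemma strongly_convex_hessian_bound:
  fixes f :: "'a::real_inner \<Rightarrow> real"
  assumes sc: "strongly_convex_modulus \<mu> f"
    and g: "\<And>y. GDERIV f y :> g y" and H: "(g has_derivative H) (at x)"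
  shows "\<mu> * (norm v)\<^sup>2 \<le> v \<bullet> H v"
proof (rule field_le_epsilon)
  fix e :: real assume e: "e > 0"
  have lin: "linear H"
    using H by (rule has_derivative_linear)
  define N where "N = (norm v)\<^sup>2 + 1"
  have N: "N > 0"
    by (simp add: N_def add_nonneg_pos)
  define c where "c = e / (2 * N)"
  have c: "c > 0"
    using e N by (simp add: c_def)
  have "2 * c * (norm v)\<^sup>2 \<le> 2 * c * N"
    using c by (simp add: N_def)
  also have "\<dots> = e"
    using N by (simp add: c_def)
  finally have ce: "2 * c * (norm v)\<^sup>2 \<le> e" .
  obtain r where r: "r > 0"
    "\<And>h. norm h < r \<Longrightarrow> \<bar>f (x + h) - f x - h \<bullet> g x - h \<bullet> H h / 2\<bar> \<le> c * (norm h)\<^sup>2"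
    using second_order_expansion[OF g H c] by metis
  define s where "s = r / (norm v + 1)"
  have s: "s > 0" using r by (simp add: s_def add_nonneg_pos)
  have "norm (s *\<^sub>R v) < r"
  proof -
    have "s * norm v < s * (norm v + 1)" using s by simp
    also have "\<dots> = r" by (simp add: s_def) (smt (verit) norm_ge_zero)
    finally show ?thesis using s by simp
  qed
  from r(2)[OF this] strongly_convex_gradient_inequality[OF sc g, of x "x + s *\<^sub>R v"]
  have "\<mu> / 2 * (norm (s *\<^sub>R v))\<^sup>2 \<le> (s *\<^sub>R v) \<bullet> H (s *\<^sub>R v) / 2 + c * (norm (s *\<^sub>R v))\<^sup>2"
    by simp
  then have "s\<^sup>2 * (\<mu> * (norm v)\<^sup>2) \<le> s\<^sup>2 * (v \<bullet> H v + 2 * c * (norm v)\<^sup>2)"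
    by (simp add: linear_cmul[OF lin] power_mult_distrib algebra_simps power2_eq_square)
  then have "\<mu> * (norm v)\<^sup>2 \<le> v \<bullet> H v + 2 * c * (norm v)\<^sup>2"
    using s by (simp add: mult_le_cancel_left)
  with ce show "\<mu> * (norm v)\<^sup>2 \<le> v \<bullet> H v + e" by linarith
qed

text \<open>
  For a quadratic form the defect in the convexity inequality is exactly \<open>t (1 - t)\<close> times the
  value of the form at \<open>x - y\<close>.
\<close>
lemma quadratic_strongly_convex:
  fixes H :: "'a::real_inner \<Rightarrow> 'a"
  assumes lin: "linear H" and pos: "\<And>v. \<mu> * (norm v)\<^sup>2 \<le> v \<bullet> H v"
  shows "strongly_convex_modulus \<mu> (\<lambda>v. v \<bullet> H v / 2)"
  unfolding strongly_convex_modulus_def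
proof (intro allI ballI)
  fix x y :: 'a and t :: real
  assume t: "t \<in> {0..1}"
  have H_eq: "H ((1 - t) *\<^sub>R x + t *\<^sub>R y) = (1 - t) *\<^sub>R H x + t *\<^sub>R H y" "H (x - y) = H x - H y"
    by (simp_all only: linear_add[OF lin] linear_diff[OF lin] linear_cmul[OF lin])
  have "((1 - t) *\<^sub>R x + t *\<^sub>R y) \<bullet> H ((1 - t) *\<^sub>R x + t *\<^sub>R y)
      = (1 - t) * (x \<bullet> H x) + t * (y \<bullet> H y) - t * (1 - t) * ((x - y) \<bullet> H (x - y))"
    unfolding H_eq
    by (simp add: inner_add_left inner_add_right inner_diff_left inner_diff_right algebra_simps)
  also have "\<dots> \<le> (1 - t) * (x \<bullet> H x) + t * (y \<bullet> H y) - t * (1 - t) * (\<mu> * (norm (x - y))\<^sup>2)"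
    using t by (intro diff_left_mono mult_left_mono pos) auto
  finally have "((1 - t) *\<^sub>R x + t *\<^sub>R y) \<bullet> H ((1 - t) *\<^sub>R x + t *\<^sub>R y) / 2
      \<le> ((1 - t) * (x \<bullet> H x) + t * (y \<bullet> H y) - t * (1 - t) * (\<mu> * (norm (x - y))\<^sup>2)) / 2"
    by (rule divide_right_mono) simp
  also have "\<dots> = (1 - t) * (x \<bullet> H x / 2) + t * (y \<bullet> H y / 2) - \<mu> / 2 * t * (1 - t) * (norm (x - y))\<^sup>2"
    by (simp add: field_simps)
  finally show "((1 - t) *\<^sub>R x + t *\<^sub>R y) \<bullet> H ((1 - t) *\<^sub>R x + t *\<^sub>R y) / 2
      \<le> (1 - t) * (x \<bullet> H x / 2) + t * (y \<bullet> H y / 2) - \<mu> / 2 * t * (1 - t) * (norm (x - y))\<^sup>2" .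
qed

section \<open>The directional derivative\<close>

text \<open>
  The minimiser \<open>w\<close> of the quadratic model \<open>\<Phi>\<close> need not be a feasible direction, so it is approximated by
  a feasible \<open>u\<close> with almost the same value of \<open>\<Phi>\<close>. For small \<open>\<alpha>\<close> the point \<open>x + \<alpha> u\<close> lies in
  \<open>X\<close> and so competes with \<open>p \<alpha>\<close>; replacing \<open>R\<close> by its second-order expansion at both points shows that
  the scaled minimiser \<open>v\<close> has \<open>\<Phi> v\<close> close to \<open>\<Phi> w\<close>, and quadratic growth makes \<open>v\<close> close to \<open>w\<close>.
\<close>
lemma scaled_minimisers_converge:
  fixes R :: "'a::real_inner \<Rightarrow> real"
  assumes mu: "\<mu> > 0" and X: "convex X" "x \<in> X"
    and g: "\<And>y. GDERIV R y :> g y" and H: "(g has_derivative H) (at x)"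
    and pX: "\<And>\<alpha>. \<alpha> > 0 \<Longrightarrow> p \<alpha> \<in> X"
    and pmin: "\<And>\<alpha> y. \<alpha> > 0 \<Longrightarrow> y \<in> X \<Longrightarrow>
        R (p \<alpha>) - p \<alpha> \<bullet> (g x + \<alpha> *\<^sub>R d) \<le> R y - y \<bullet> (g x + \<alpha> *\<^sub>R d)"
    and pbound: "\<And>\<alpha>. \<alpha> > 0 \<Longrightarrow> norm (p \<alpha> - x) \<le> \<alpha> * B"
    and w: "w \<in> closure (feasible_directions X x)"
    and growth: "\<And>v. v \<in> feasible_directions X x \<Longrightarrow>
        w \<bullet> H w / 2 - w \<bullet> d + \<mu> / 2 * (norm (v - w))\<^sup>2 \<le> v \<bullet> H v / 2 - v \<bullet> d"
  shows "((\<lambda>\<alpha>. (p \<alpha> - x) /\<^sub>R \<alpha>) \<longlongrightarrow> w) (at_right 0)"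
proof (rule tendstoI)
  fix e :: real assume e: "e > 0"
  define \<Phi> where "\<Phi> v = v \<bullet> H v / 2 - v \<bullet> d" for v
  have lin: "linear H" and blin: "bounded_linear H"
    using H by (auto intro: has_derivative_linear has_derivative_bounded_linear)
  have contH: "isCont H v" for v
    using blin by (rule linear_continuous_at)
  have cont: "isCont \<Phi> w"
    unfolding \<Phi>_def by (intro continuous_intros contH) auto
  \<comment> \<open>The excess of \<open>\<Phi>\<close> over its minimum that still forces a distance less than \<open>e\<close>;
    half of it is spent on \<open>u\<close> and a quarter on each of the two expansions.\<close>
  define \<eta> where "\<eta> = \<mu> / 2 * e\<^sup>2"
  have \<eta>: "\<eta> > 0" using mu e by (simp add: \<eta>_def)
  obtain u where u: "u \<in> feasible_directions X x" and \<Phi>u: "\<Phi> u < \<Phi> w + \<eta> / 2"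
  proof -
    have "\<forall>\<^sub>F v in nhds w. \<Phi> v < \<Phi> w + \<eta> / 2"
      using cont \<eta> unfolding isCont_def tendsto_at_iff_tendsto_nhds by (intro order_tendstoD) auto
    then obtain S where "open S" "w \<in> S" "\<And>v. v \<in> S \<Longrightarrow> \<Phi> v < \<Phi> w + \<eta> / 2"
      unfolding eventually_nhds by blast
    with w that show thesis
      by (metis disjoint_iff open_Int_closure_eq_empty)
  qed
  obtain t0 where t0: "t0 > 0" "x + t0 *\<^sub>R u \<in> X"
    using u by (auto simp: feasible_directions_def)
  define M where "M = max B (norm u) + 1"
  have M: "M > 0" "B \<le> M" "norm u \<le> M"
    by (auto simp: M_def le_max_iff_disj intro!: add_nonneg_pos)
  define c where "c = \<eta> / (4 * M\<^sup>2)"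
  have c: "c > 0" "c * M\<^sup>2 = \<eta> / 4"
    using \<eta> M by (auto simp: c_def)
  obtain r where r: "r > 0"
    and taylor: "\<And>h. norm h < r \<Longrightarrow>
      \<bar>R (x + h) - R x - h \<bullet> g x - h \<bullet> H h / 2\<bar> \<le> c * (norm h)\<^sup>2"
    using second_order_expansion[OF g H c(1)] by metis
  define a0 where "a0 = min t0 (r / M)"
  have a0: "a0 > 0" using t0 r M by (simp add: a0_def)
  have "dist ((p \<alpha> - x) /\<^sub>R \<alpha>) w < e" if \<alpha>: "0 < \<alpha>" "\<alpha> < a0" for \<alpha>
  proof -
    define v where "v = (p \<alpha> - x) /\<^sub>R \<alpha>"
    have p: "p \<alpha> = x + \<alpha> *\<^sub>R v" using \<alpha> by (simp add: v_def)
    have vF: "v \<in> feasible_directions X x"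
      using pX[OF \<alpha>(1)] \<alpha> unfolding p feasible_directions_def by blast
    have nv: "norm v \<le> M"
      using pbound[OF \<alpha>(1)] \<alpha> M unfolding p by simp
    have model: "\<bar>R (x + \<alpha> *\<^sub>R h) - (x + \<alpha> *\<^sub>R h) \<bullet> (g x + \<alpha> *\<^sub>R d)
        - (R x - x \<bullet> (g x + \<alpha> *\<^sub>R d)) - \<alpha>\<^sup>2 * \<Phi> h\<bar> \<le> \<alpha>\<^sup>2 * (\<eta> / 4)" if h: "norm h \<le> M" for h
    proof -
      have "\<alpha> * norm h \<le> \<alpha> * M" using h \<alpha> by simp
      also have "\<dots> < r" using \<alpha> M by (simp add: a0_def pos_less_divide_eq)
      finally have "norm (\<alpha> *\<^sub>R h) < r" using \<alpha> by simp
      note taylor[OF this]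
      also have "c * (norm (\<alpha> *\<^sub>R h))\<^sup>2 \<le> \<alpha>\<^sup>2 * (c * M\<^sup>2)"
        using h c(1) by (simp add: power_mult_distrib mult.left_commute mult_left_mono power_mono)
      finally show ?thesis
        unfolding c(2) \<Phi>_def
        by (simp add: linear_cmul[OF lin] inner_add_left inner_add_right power2_eq_square algebra_simps)
    qed
    have "x + \<alpha> *\<^sub>R u \<in> X"
      using convex_shorter_step[OF X t0(2)] \<alpha> by (simp add: a0_def)
    from pmin[OF \<alpha>(1) this] model[OF nv] model[OF M(3)]
    have "\<alpha>\<^sup>2 * \<Phi> v \<le> \<alpha>\<^sup>2 * \<Phi> u + 2 * (\<alpha>\<^sup>2 * (\<eta> / 4))"
      unfolding p by linarith
    then have "\<alpha>\<^sup>2 * \<Phi> v \<le> \<alpha>\<^sup>2 * (\<Phi> u + \<eta> / 2)"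
      by (simp add: distrib_left mult.commute)
    then have "\<Phi> v \<le> \<Phi> u + \<eta> / 2"
      using \<alpha> by (simp add: mult_le_cancel_left)
    with \<Phi>u growth[OF vF] have "\<mu> / 2 * (norm (v - w))\<^sup>2 < \<mu> / 2 * e\<^sup>2"
      unfolding \<Phi>_def[symmetric] \<eta>_def by linarith
    then have "(norm (v - w))\<^sup>2 < e\<^sup>2"
      using mu by simp
    then have "norm (v - w) < e"
      by (rule power2_less_imp_less) (use e in simp)
    then show ?thesis by (simp add: v_def dist_norm)
  qed
  then show "\<forall>\<^sub>F \<alpha> in at_right 0. dist ((p \<alpha> - x) /\<^sub>R \<alpha>) w < e"
    using a0 unfolding eventually_at_right_field by blast
qed

text \<open>
  Completing the square: by symmetry of the Hessian and \<open>\<nabla>\<^sup>2R x y = d\<close>, the squared local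
  distance from \<open>v\<close> to \<open>y\<close> is \<open>2 (v \<bullet> \<nabla>\<^sup>2R x v / 2 - v \<bullet> d) + y \<bullet> d\<close>.
\<close>
lemma local_projection_eqI:
  assumes w: "w \<in> T"
    and sym: "\<And>u v. u \<bullet> (hessian R x *v v) = v \<bullet> (hessian R x *v u)"
    and y: "hessian R x *v y = d"
    and min: "\<And>v. v \<in> T \<Longrightarrow> v \<noteq> w \<Longrightarrow>
        w \<bullet> (hessian R x *v w) / 2 - w \<bullet> d < v \<bullet> (hessian R x *v v) / 2 - v \<bullet> d"
  shows "local_projection R x T y = w"
proof -
  have expand: "local_norm_sq R x (v - y)
      = 2 * (v \<bullet> (hessian R x *v v) / 2 - v \<bullet> d) + y \<bullet> d" for v
    using sym[of y v]
    by (simp add: local_norm_sq_def matrix_vector_mult_diff_distrib inner_diff_left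
        inner_diff_right y algebra_simps)
  have less: "local_norm_sq R x (w - y) < local_norm_sq R x (v - y)" if "v \<in> T" "v \<noteq> w" for v
    using min[OF that] unfolding expand by simp
  show ?thesis
    unfolding local_projection_def arg_min_def is_arg_min_def
    using w less by (intro some_equality) (auto, metis less_asym)
qed

theorem theorem3:
  fixes R :: "real^'n \<Rightarrow> real" and X :: "(real^'n) set" and x d :: "real^'n"
  assumes "twice_continuously_differentiable R"
    and "strongly_convex R"
    and "closed X" and "convex X"
    and "x \<in> X"
  shows "((\<lambda>\<alpha>. (ereal_gradient (convex_conjugate (restrict_ext R X)) (gradient R x + \<alpha> *\<^sub>R d)
              - ereal_gradient (convex_conjugate (restrict_ext R X)) (gradient R x)) /\<^sub>R \<alpha>)
          \<longlongrightarrow> local_projection R x (tangent_cone X x) (matrix_inv (hessian R x) *v d))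
         (at_right 0)"
proof -
  define g where "g = gradient R"
  define A where "A = hessian R x"
  define T where "T = tangent_cone X x"
  obtain \<mu> where mu: "\<mu> > 0" and sc: "strongly_convex_modulus \<mu> R"
    using assms(2) unfolding strongly_convex_def strongly_convex_modulus_def by blast
  have g: "GDERIV R y :> g y" for y
    using assms(1) unfolding g_def twice_continuously_differentiable_def
    by (blast intro: GDERIV_gradient)
  have H: "(g has_derivative (\<lambda>h. A *v h)) (at x)"
    using assms(1) unfolding g_def A_def hessian_def twice_continuously_differentiable_def
    by (simp add: jacobian_works)
  have lin: "linear (\<lambda>h. A *v h)"
    using H by (rule has_derivative_linear)
  have pos: "\<mu> * (norm v)\<^sup>2 \<le> v \<bullet> (A *v v)" for v
    using strongly_convex_hessian_bound[OF sc g H] .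
  have sym: "u \<bullet> (A *v v) = v \<bullet> (A *v u)" for u v
    using derivative_of_gradient_symmetric[OF g H] .
  have inv: "A *v (matrix_inv A *v d) = d"
  proof -
    have "v = 0" if "A *v v = 0" for v
      using pos[of v] that mu by (simp add: mult_le_0_iff)
    then have "invertible A"
      using matrix_left_invertible_ker invertible_left_inverse by blast
    then have "A ** matrix_inv A = mat 1"
      unfolding invertible_def matrix_inv_def by (rule someI2_ex) blast
    then show ?thesis
      by (simp add: matrix_vector_mul_assoc)
  qed

  have "\<forall>z. \<exists>p. p \<in> X \<and> (\<forall>y\<in>X. R p - p \<bullet> z + \<mu> / 2 * (norm (y - p))\<^sup>2 \<le> R y - y \<bullet> z)"
  proof
    fix z
    have "continuous_on X (\<lambda>y. R y - y \<bullet> z)"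
      using g unfolding gderiv_def
      by (intro continuous_intros has_derivative_continuous_on) (blast intro: has_derivative_at_withinI)
    moreover have "GDERIV (\<lambda>y. R y - y \<bullet> z) x :> g x - z"
      using g[of x] unfolding gderiv_def
      by (auto intro!: derivative_eq_intros simp: inner_diff_right)
    ultimately obtain p where "p \<in> X"
        "\<And>y. y \<in> X \<Longrightarrow> R p - p \<bullet> z + \<mu> / 2 * (norm (y - p))\<^sup>2 \<le> R y - y \<bullet> z"
      by (rule strongly_convex_minimiser[OF mu strongly_convex_modulus_minus_linear[OF sc] assms(3-5)]) blast
    then show "\<exists>p. p \<in> X \<and> (\<forall>y\<in>X. R p - p \<bullet> z + \<mu> / 2 * (norm (y - p))\<^sup>2 \<le> R y - y \<bullet> z)"
      by blast
  qed
  from choice[OF this] obtain p where pX: "\<And>z. p z \<in> X"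
    and growth: "\<And>z y. y \<in> X \<Longrightarrow> R (p z) - p z \<bullet> z + \<mu> / 2 * (norm (y - p z))\<^sup>2 \<le> R y - y \<bullet> z"
    by blast
  have grad: "ereal_gradient (convex_conjugate (restrict_ext R X)) z = p z" for z
    by (rule ereal_gradient_conjugate[OF mu pX growth])
  have px: "p (g x) = x"
  proof -
    have "\<mu> * (norm (x - p (g x)))\<^sup>2 \<le> 0"
      using growth[OF assms(5), of "g x"] strongly_convex_gradient_inequality[OF sc g, of x "p (g x)"]
      by (simp add: inner_diff_left norm_minus_commute)
    then show ?thesis using mu by (simp add: mult_le_0_iff)
  qed

  have T: "T = closure (feasible_directions X x)"
    unfolding T_def using assms by (intro tangent_cone_eq_closure)
  obtain w where w: "w \<in> T"
    and w_growth: "\<And>v. v \<in> T \<Longrightarrow> w \<bullet> (A *v w) / 2 - w \<bullet> d + \<mu> / 2 * (norm (v - w))\<^sup>2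
        \<le> v \<bullet> (A *v v) / 2 - v \<bullet> d"
  proof (rule strongly_convex_minimiser[OF mu strongly_convex_modulus_minus_linear[OF
        quadratic_strongly_convex[OF lin pos], of d], of T 0 "- d"])
    show "closed T" "convex T"
      using assms by (auto simp: T intro!: convex_closure convex_feasible_directions)
    have "0 \<in> feasible_directions X x"
      using assms by (auto simp: feasible_directions_def intro: exI[of _ 1])
    then show "0 \<in> T"
      unfolding T using closure_subset by blast
    have d: "((\<lambda>v. v \<bullet> (A *v v) / 2 - v \<bullet> d) has_derivative
        (\<lambda>h. (y \<bullet> (A *v h) + h \<bullet> (A *v y)) / 2 - h \<bullet> d)) (at y)" for y
      by (auto intro!: derivative_eq_intros
          bounded_linear.has_derivative[OF matrix_vector_mul_bounded_linear])
    show "continuous_on T (\<lambda>v. v \<bullet> (A *v v) / 2 - v \<bullet> d)"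
      using d by (intro has_derivative_continuous_on) (blast intro: has_derivative_at_withinI)
    show "GDERIV (\<lambda>v. v \<bullet> (A *v v) / 2 - v \<bullet> d) 0 :> - d"
      using d[of 0] by (simp add: gderiv_def)
  qed (use that in blast)

  have "((\<lambda>\<alpha>. (p (g x + \<alpha> *\<^sub>R d) - x) /\<^sub>R \<alpha>) \<longlongrightarrow> w) (at_right 0)"
  proof (rule scaled_minimisers_converge[OF mu assms(4,5) g H, where B = "norm d / \<mu>"])
    show "p (g x + \<alpha> *\<^sub>R d) \<in> X" for \<alpha> by (rule pX)
    show "R (p (g x + \<alpha> *\<^sub>R d)) - p (g x + \<alpha> *\<^sub>R d) \<bullet> (g x + \<alpha> *\<^sub>R d)
        \<le> R y - y \<bullet> (g x + \<alpha> *\<^sub>R d)" if "y \<in> X" for y \<alpha>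
      using growth[OF that, of "g x + \<alpha> *\<^sub>R d"] mu
      by (smt (verit) mult_nonneg_nonneg half_gt_zero zero_le_power2)
    show "norm (p (g x + \<alpha> *\<^sub>R d) - x) \<le> \<alpha> * (norm d / \<mu>)" if "\<alpha> > 0" for \<alpha>
      using argmin_selection_Lipschitz[OF mu pX growth, of "g x + \<alpha> *\<^sub>R d" "g x"] that px by simp
    show "w \<in> closure (feasible_directions X x)" using w T by simp
    show "w \<bullet> (A *v w) / 2 - w \<bullet> d + \<mu> / 2 * (norm (v - w))\<^sup>2 \<le> v \<bullet> (A *v v) / 2 - v \<bullet> d"
      if "v \<in> feasible_directions X x" for v
      using that closure_subset T by (intro w_growth) blast
  qed
  moreover have "local_projection R x T (matrix_inv A *v d) = w"
  proof (rule local_projection_eqI[OF w, of R x, folded A_def, OF sym inv])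
    fix v assume v: "v \<in> T" "v \<noteq> w"
    then have "0 < \<mu> / 2 * (norm (v - w))\<^sup>2" using mu by simp
    with w_growth[OF v(1)] show "w \<bullet> (A *v w) / 2 - w \<bullet> d < v \<bullet> (A *v v) / 2 - v \<bullet> d"
      by linarith
  qed
  ultimately show ?thesis
    unfolding grad g_def[symmetric] px A_def[symmetric] T_def[symmetric] by simp
qed

end
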